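(* Let $G$ and $H$ be connected strongly $2$-monophonic graphs, neither of which is isomorphic to $P_3$. Then the Cartesian product $G\,\Box\, H$ is strongly $2$-monophonic.
   Context: All graphs are finite and simple. The Cartesian product $G\Box H$ has vertex set $V(G)\times V(H)$, with $(g,h)$ adjacent to $(g',h')$ iff either $g=g'$ and $hh'\in E(H)$, or $h=h'$ and $gg'\in E(G)$. For a graph $G$ and $u,v\in V(G)$, the monophonic interval $J_G(u,v)$ is the set of all vertices lying on some induced $u,v$-path in $G$, with the convention $u,v\in J_G(u,v)$ and $J_G(u,u)=\{u\}$. A set $S\subseteq V(G)$ is monophonic if for every $w\in V(G)$ there exist $x,y\in S$ with $w\in J_G(x,y)$; $m(G)$ is the minimum size of a monophonic set. $G$ is $2$-monophonic if $m(G)=2$, and strongly $2$-monophonic if it is $2$-monophonic and $\{x,y\}$ is a monophonic set for every pair of non-adjacent vertices $x,y$. *)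

theory Defs
  imports "Graph_Theory.Digraph_Isomorphism" "Graph_Theory.Digraph_Component" "Graph_Theory.Vertex_Walk"
begin

text \<open>
  A finite simple graph is a \<^locale>\<open>pair_graph\<close>: a finite loopfree digraph without parallel
  arcs whose arc set is symmetric, an edge being represented by its two opposite arcs.
\<close>

definition cart_prod :: "'a pair_pre_digraph \<Rightarrow> 'b pair_pre_digraph \<Rightarrow> ('a \<times> 'b) pair_pre_digraph"
  (infixl "\<box>" 70) where
  "G \<box> H = \<lparr> pverts = pverts G \<times> pverts H,
     parcs = {((g, h), (g', h')). (g, h) \<in> pverts G \<times> pverts H \<and> (g', h') \<in> pverts G \<times> pverts H \<and>
       (g = g' \<and> (h, h') \<in> parcs H \<or> h = h' \<and> (g, g') \<in> parcs G)} \<rparr>"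

lemma pair_graph_cart_prod:
  assumes "pair_graph G" "pair_graph H"
  shows "pair_graph (G \<box> H)"
proof -
  interpret G: pair_graph G by fact
  interpret H: pair_graph H by fact
  have fin: "finite (pverts (G \<box> H))"
    by (simp add: cart_prod_def G.pair_finite_verts H.pair_finite_verts)
  have "parcs (G \<box> H) \<subseteq> pverts (G \<box> H) \<times> pverts (G \<box> H)"
    by (auto simp: cart_prod_def)
  then have "finite (parcs (G \<box> H))"
    using fin finite_subset by blast
  moreover have "sym (parcs (G \<box> H))"
    using G.pair_sym_arcs H.pair_sym_arcs
    by (auto simp: cart_prod_def symmetric_def sym_def)
  ultimately show ?thesis
    using fin
    by unfold_locales
      (auto simp: cart_prod_def symmetric_def dest: G.no_loops' H.no_loops')
qed

text \<open>
  The path with \<open>n\<close> vertices, so that \<open>path_graph 3\<close> is \<open>P\<^sub>3\<close>.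
\<close>

definition path_graph :: "nat \<Rightarrow> nat pair_pre_digraph" where
  "path_graph n = \<lparr> pverts = {..<n},
     parcs = {(i, j). i < n \<and> j < n \<and> (j = Suc i \<or> i = Suc j)} \<rparr>"

text \<open>
  A path, given by its vertex list, is induced if the subgraph induced by its vertices has no
  edges other than those of the path; each of the latter contributes both of its arcs.
\<close>

definition induced_path :: "'a pair_pre_digraph \<Rightarrow> 'a \<Rightarrow> 'a vwalk \<Rightarrow> 'a \<Rightarrow> bool" where
  "induced_path G u p v \<longleftrightarrow> vpath p (with_proj G) \<and> hd p = u \<and> last p = v \<and>
     arcs (with_proj G \<restriction> set p) = set (vwalk_arcs p) \<union> (set (vwalk_arcs p))\<inverse>"

text \<open>
  The endpoints are added explicitly because there may be no path between them. For a vertex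
  \<open>u\<close>, the only path from \<open>u\<close> to \<open>u\<close> is \<open>[u]\<close>, so the interval is \<open>{u}\<close>.
\<close>

definition mono_interval :: "'a pair_pre_digraph \<Rightarrow> 'a \<Rightarrow> 'a \<Rightarrow> 'a set" where
  "mono_interval G u v = {u, v} \<union> {w. \<exists>p. induced_path G u p v \<and> w \<in> set p}"

lemma mono_interval_refl: "mono_interval G u u = {u}"
proof -
  have "set p \<subseteq> {u}" if "induced_path G u p u" for p
    using that by (cases p) (auto simp: induced_path_def vpath_def split: if_splits)
  then show ?thesis by (auto simp: mono_interval_def)
qed

definition monophonic_set :: "'a pair_pre_digraph \<Rightarrow> 'a set \<Rightarrow> bool" where
  "monophonic_set G S \<longleftrightarrow> S \<subseteq> pverts G \<and>
     (\<forall>w \<in> pverts G. \<exists>x \<in> S. \<exists>y \<in> S. w \<in> mono_interval G x y)"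

text \<open>
  In a finite graph the minimum exists, since the set of all vertices is monophonic.
\<close>

definition monophonic_number :: "'a pair_pre_digraph \<Rightarrow> nat" where
  "monophonic_number G = (LEAST k. \<exists>S. monophonic_set G S \<and> card S = k)"

definition two_monophonic :: "'a pair_pre_digraph \<Rightarrow> bool" where
  "two_monophonic G \<longleftrightarrow> monophonic_number G = 2"

definition strongly_two_monophonic :: "'a pair_pre_digraph \<Rightarrow> bool" where
  "strongly_two_monophonic G \<longleftrightarrow> two_monophonic G \<and>
     (\<forall>x \<in> pverts G. \<forall>y \<in> pverts G. x \<noteq> y \<and> (x, y) \<notin> parcs G \<longrightarrow> monophonic_set G {x, y})"

end

theory Submission
  imports Defs
begin

text \<open>
  A strongly 2-monophonic graph has no cut vertex unless it is \<open>P\<^sub>3\<close>: if \<open>x\<close> and \<open>y\<close> are nonadjacent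
  neighbours of \<open>g\<close>, any further vertex lies on an induced \<open>x,y\<close>-path, and this path avoids \<open>g\<close>. Hence for
  every edge \<open>gg'\<close> and every \<open>x\<close> there are induced paths \<open>R\<^sub>1\<close> from \<open>g\<close> to \<open>x\<close> and \<open>R\<^sub>2\<close> from \<open>x\<close> to \<open>g'\<close>
  that meet only in \<open>x\<close>. Let \<open>(g, h)\<close> and \<open>(g', h')\<close> be nonadjacent. If \<open>h\<close>, \<open>h'\<close> are distinct and nonadjacent,
  then \<open>(x, y)\<close> is reached by moving from \<open>g\<close> to \<open>x\<close> at height \<open>h\<close>, climbing along an induced \<open>h,h'\<close>-path
  through \<open>y\<close>, and moving on to \<open>g'\<close> at height \<open>h'\<close>; the case of \<open>g\<close>, \<open>g'\<close> is symmetric. If \<open>gg'\<close> and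
  \<open>hh'\<close> are edges, with \<open>S\<^sub>1\<close>, \<open>S\<^sub>2\<close> chosen for \<open>h\<close>, \<open>y\<close>, \<open>h'\<close> like \<open>R\<^sub>1\<close>, \<open>R\<^sub>2\<close>, then the staircase along \<open>R\<^sub>1\<close>,
  \<open>S\<^sub>1\<close>, \<open>R\<^sub>2\<close>, \<open>S\<^sub>2\<close> is an induced path if \<open>x \<noteq> g'\<close> and \<open>y \<noteq> h\<close>, and the one along \<open>S\<^sub>1\<close>, \<open>R\<^sub>1\<close>, \<open>S\<^sub>2\<close>, \<open>R\<^sub>2\<close>
  if \<open>x \<noteq> g\<close> and \<open>y \<noteq> h'\<close>; otherwise \<open>(x, y)\<close> is an endpoint.
\<close>

section \<open>Induced paths as vertex sets\<close>

text \<open>\<open>S\<close> is the vertex set of an induced path from \<open>u\<close> to \<open>v\<close>.\<close>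

inductive ipath :: "'a pair_pre_digraph \<Rightarrow> 'a \<Rightarrow> 'a set \<Rightarrow> 'a \<Rightarrow> bool" for G where
  single: "v \<in> pverts G \<Longrightarrow> ipath G v {v} v"
| step: "ipath G w S v \<Longrightarrow> (u, w) \<in> parcs G \<Longrightarrow> u \<notin> S \<Longrightarrow>
    (\<And>s. s \<in> S \<Longrightarrow> (u, s) \<in> parcs G \<Longrightarrow> s = w) \<Longrightarrow> ipath G u (insert u S) v"

lemma ipath_ends: "ipath G u S v \<Longrightarrow> u \<in> S \<and> v \<in> S"
  by (induction rule: ipath.induct) auto

lemma ipath_to_self: "ipath G u S v \<Longrightarrow> u = v \<Longrightarrow> S = {u}"
  by (induction rule: ipath.induct) (auto dest: ipath_ends)

text \<open>Chords at \<open>w\<close> are already excluded within \<open>S\<close> and within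
  \<open>T\<close>, so only pairs that avoid \<open>w\<close> need a hypothesis.\<close>

lemma ipath_append:
  assumes "ipath G u S w" "ipath G w T v" "S \<inter> T = {w}"
    and "\<And>s t. s \<in> S - {w} \<Longrightarrow> t \<in> T - {w} \<Longrightarrow> (s, t) \<notin> parcs G"
  shows "ipath G u (S \<union> T) v"
  using assms
proof (induction rule: ipath.induct)
  case (single w)
  then have "{w} \<union> T = T" by (auto dest: ipath_ends)
  with single show ?case by simp
next
  case (step w' S w u)
  have w: "w \<in> S" "w' \<in> S" "w \<in> T" using step.hyps(1) step.prems(1) by (simp_all add: ipath_ends)
  have "ipath G w' (S \<union> T) v"
    using step.prems w by (intro step.IH) blast+
  moreover have "u \<notin> S \<union> T" using step.prems(2) step.hyps(3) w by auto
  moreover have "s = w'" if "s \<in> S \<union> T" "(u, s) \<in> parcs G" for s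
    using that step.hyps(3) step.hyps(4)[of s] step.prems(3)[of u s] w by auto
  ultimately show ?case using step.hyps(2) ipath.step[of G w' "S \<union> T" v u] by simp
qed

context pair_graph
begin

lemma arc_sym: "(u, v) \<in> parcs G \<Longrightarrow> (v, u) \<in> parcs G"
  using pair_sym_arcs by (auto simp: symmetric_def sym_def)

lemma ipath_vertices: "ipath G u S v \<Longrightarrow> S \<subseteq> pverts G"
  by (induction rule: ipath.induct) (auto intro: in_arcsD1)

lemma ipath_edge: "(u, v) \<in> parcs G \<Longrightarrow> ipath G u {u, v} v"
  using ipath.step[OF ipath.single, of v G u] by (auto dest: in_arcsD2 no_loops')

lemma ipath_rev: "ipath G u S v \<Longrightarrow> ipath G v S u"
proof (induction rule: ipath.induct)
  case (step w S v u)
  have "ipath G v (S \<union> {w, u}) u"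
  proof (rule ipath_append[OF step.IH ipath_edge])
    show "(w, u) \<in> parcs G" using step.hyps by (simp add: arc_sym)
    have w: "w \<in> S" using step.hyps(1) by (simp add: ipath_ends)
    then show "S \<inter> {w, u} = {w}" using step.hyps(3) by auto
    show "(s, t) \<notin> parcs G" if "s \<in> S - {w}" "t \<in> {w, u} - {w}" for s t
      using that step.hyps(4)[of s] arc_sym[of s t] by auto
  qed
  moreover have "S \<union> {w, u} = insert u S" using ipath_ends[OF step.hyps(1)] by auto
  ultimately show ?case by simp
qed (rule ipath.single)

lemma ipath_split:
  "ipath G u S v \<Longrightarrow> z \<in> S \<Longrightarrow> \<exists>A B. ipath G u A z \<and> ipath G z B v \<and> A \<inter> B = {z} \<and> A \<union> B = S"
proof (induction rule: ipath.induct)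
  case (single v)
  then show ?case by (intro exI[of _ "{v}"]) (auto intro: ipath.single)
next
  case (step w S v u)
  show ?case
  proof (cases "z \<in> S")
    case True
    then obtain A B where "ipath G w A z" "ipath G z B v" "A \<inter> B = {z}" "A \<union> B = S"
      using step.IH by auto
    moreover from this have "ipath G u (insert u A) z"
      using step.hyps by (intro ipath.step) auto
    ultimately show ?thesis using step.hyps
      by (intro exI[of _ "insert u A"] exI[of _ B]) auto
  next
    case False
    then have "z = u" using step.prems by auto
    show ?thesis
    proof (intro exI conjI)
      show "ipath G z (insert u S) v" unfolding \<open>z = u\<close> using step.hyps by (rule ipath.step)
      show "ipath G u {u} z" using \<open>z = u\<close> step.hyps by (auto intro: ipath.single in_arcsD1)
    qed (use \<open>z = u\<close> in auto)
  qed
qed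

text \<open>Serves to stop a detour at its first contact with an earlier configuration
  \<open>U\<close>.\<close>

lemma ipath_first_hit:
  "ipath G x P z \<Longrightarrow> z \<in> U \<Longrightarrow> \<exists>P' z'. ipath G x P' z' \<and> P' \<subseteq> P \<and> P' \<inter> U = {z'}"
proof (induction rule: ipath.induct)
  case (single v)
  then show ?case by (intro exI[of _ "{v}"] exI[of _ v]) (auto intro: ipath.single)
next
  case (step w S v u)
  then obtain P z where P: "ipath G w P z" "P \<subseteq> S" "P \<inter> U = {z}" by auto
  then have "ipath G u (insert u P) z"
    using step.hyps by (intro ipath.step) auto
  show ?case
  proof (cases "u \<in> U")
    case True
    have "u \<in> pverts G" using step.hyps in_arcsD1 by blast
    then show ?thesis using True by (intro exI[of _ "{u}"] exI[of _ u]) (auto intro: ipath.single)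
  next
    case False
    then show ?thesis using P \<open>ipath G u (insert u P) z\<close> by blast
  qed
qed

text \<open>The path is entered at its last vertex equal or adjacent to \<open>u\<close>, so no
  later vertex gives a chord. The shortcut may drop vertices, hence the mere inclusion.\<close>

lemma ipath_extend:
  "ipath G w T v \<Longrightarrow> u \<in> T \<or> (\<exists>t \<in> T. (u, t) \<in> parcs G) \<Longrightarrow> \<exists>T' \<subseteq> insert u T. ipath G u T' v"
proof (induction rule: ipath.induct)
  case (single v)
  then show ?case using ipath.single[of v G] ipath_edge[of u v] by auto
next
  case (step w T v x)
  show ?case
  proof (cases "u \<in> T \<or> (\<exists>t \<in> T. (u, t) \<in> parcs G)")
    case True
    then show ?thesis using step.IH by blast
  next
    case notin: False
    have x: "ipath G x (insert x T) v" using step.hyps by (rule ipath.step)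
    show ?thesis
    proof (cases "u = x")
      case True
      then show ?thesis using x by blast
    next
      case False
      with notin step.prems have "ipath G u (insert u (insert x T)) v"
        by (intro ipath.step[OF x]) auto
      then show ?thesis by blast
    qed
  qed
qed

lemma ipath_concat:
  "ipath G u S w \<Longrightarrow> ipath G w T v \<Longrightarrow> \<exists>X \<subseteq> S \<union> T. ipath G u X v"
proof (induction rule: ipath.induct)
  case (step w' S w u)
  then obtain X where X: "X \<subseteq> S \<union> T" "ipath G w' X v" by auto
  with step.hyps(2) have "\<exists>X' \<subseteq> insert u X. ipath G u X' v"
    by (intro ipath_extend) (auto dest: ipath_ends)
  then show ?case using X(1) by blast
qed blast

lemma ipath_if_connected:
  assumes "Digraph_Component.connected (with_proj G)" "u \<in> pverts G" "v \<in> pverts G"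
  shows "\<exists>S. ipath G u S v"
proof -
  \<comment> \<open>Connectivity refers to the symmetric closure, which changes nothing
    here.\<close>
  have *: "pverts (mk_symmetric G) = pverts G" "parcs (mk_symmetric G) = parcs G"
    by (auto simp: mk_symmetric_def arc_sym)
  have "(u, v) \<in> rtrancl_on (pverts G) (parcs G)"
    using assms * by (auto simp: connected_def strongly_connected_def reachable_def)
  then show ?thesis
  proof (induction rule: converse_rtrancl_on_induct)
    case base
    then show ?case using ipath.single by fast
  next
    case (step x y)
    then obtain S where "ipath G y S v" by blast
    then show ?case using ipath_extend[of y S v x] step.hyps by (blast dest: ipath_ends)
  qed
qed

section \<open>Monophonic sets in terms of \<open>ipath\<close>\<close>

text \<open>Deleting the first vertex of a longer path deletes exactly the arcs at \<open>u\<close>,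
  so the tail is induced again and \<open>u\<close> has no neighbour on it but the successor
  \<open>w\<close>.\<close>

lemma ipath_if_induced_path:
  "induced_path G u p v \<Longrightarrow> ipath G u (set p) v"
proof (induction p arbitrary: u)
  case Nil
  then show ?case by (auto simp: induced_path_def vpath_def vwalk_def)
next
  case (Cons a p)
  then have [simp]: "a = u" by (simp add: induced_path_def)
  have arcs: "{e \<in> parcs G. fst e \<in> insert u (set p) \<and> snd e \<in> insert u (set p)} =
    set (vwalk_arcs (u # p)) \<union> (set (vwalk_arcs (u # p)))\<inverse>"
    using Cons.prems by (auto simp: induced_path_def induce_subgraph_def)
  show ?case
  proof (cases p)
    case Nil
    then show ?thesis using Cons.prems
      by (auto simp: induced_path_def vpath_def vwalk_def intro: ipath.single)
  next
    case (Cons w q)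
    have sub: "x \<in> set p \<and> y \<in> set p" if "(x, y) \<in> set (vwalk_arcs p)" for x y
      using that by (induction p rule: vwalk_arcs.induct) auto
    have u: "u \<notin> set p" using Cons.prems by (auto simp: induced_path_def vpath_def)
    have va: "set (vwalk_arcs (u # p)) = insert (u, w) (set (vwalk_arcs p))"
      using Cons by simp
    have "induced_path G w p v"
      unfolding induced_path_def
    proof (intro conjI)
      show "vpath p (with_proj G)" "hd p = w" "last p = v"
        using Cons.prems Cons by (auto simp: induced_path_def vpath_def vwalk_def)
      have "{e \<in> parcs G. fst e \<in> set p \<and> snd e \<in> set p} =
          set (vwalk_arcs p) \<union> (set (vwalk_arcs p))\<inverse>"
        proof (rule set_eqI)
        fix e
        obtain a b :: 'a where e: "e = (a, b)" by fastforce
        have "(a, b) \<in> {e \<in> parcs G. fst e \<in> insert u (set p) \<and> snd e \<in> insert u (set p)} \<longleftrightarrow>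
            (a, b) \<in> insert (u, w) (set (vwalk_arcs p)) \<union> (insert (u, w) (set (vwalk_arcs p)))\<inverse>"
          using arcs[unfolded va] by simp
        then show "e \<in> {e \<in> parcs G. fst e \<in> set p \<and> snd e \<in> set p} \<longleftrightarrow>
            e \<in> set (vwalk_arcs p) \<union> (set (vwalk_arcs p))\<inverse>"
          using sub[of a b] sub[of b a] u e by auto
      qed
      then show "arcs (with_proj G \<restriction> set p) = set (vwalk_arcs p) \<union> (set (vwalk_arcs p))\<inverse>"
        by (simp add: induce_subgraph_def)
    qed
    then have "ipath G w (set p) v" by (rule Cons.IH)
    moreover have "(u, w) \<in> parcs G" using arcs[unfolded va] by auto
    moreover have "s = w" if "s \<in> set p" "(u, s) \<in> parcs G" for s
    proof -
      have "(u, s) \<in> {e \<in> parcs G. fst e \<in> insert u (set p) \<and> snd e \<in> insert u (set p)}"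
        using that by simp
      then show ?thesis unfolding arcs va using that u sub by auto
    qed
    ultimately show ?thesis using u ipath.step[of G w "set p" v u] by simp
  qed
qed

lemma induced_path_if_ipath:
  "ipath G u S v \<Longrightarrow> \<exists>p. induced_path G u p v \<and> set p = S"
proof (induction rule: ipath.induct)
  case (single v)
  then have "induced_path G v [v] v"
    by (auto simp: induced_path_def vpath_def vwalk_def induce_subgraph_def dest: no_loops')
  then show ?case by (intro exI[of _ "[v]"]) simp
next
  case (step w S v u)
  then obtain p where p: "induced_path G w p v" "set p = S" by blast
  then have ne: "p \<noteq> []" "hd p = w" by (auto simp: induced_path_def vpath_def vwalk_def)
  have "{e \<in> parcs G. fst e \<in> S \<and> snd e \<in> S} = set (vwalk_arcs p) \<union> (set (vwalk_arcs p))\<inverse>"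
    using p by (auto simp: induced_path_def induce_subgraph_def)
  moreover have "{e \<in> parcs G. fst e \<in> insert u S \<and> snd e \<in> insert u S} =
      {(u, w), (w, u)} \<union> {e \<in> parcs G. fst e \<in> S \<and> snd e \<in> S}"
  proof (rule set_eqI)
    fix e
    obtain a b :: 'a where e: "e = (a, b)" by fastforce
    have "w \<in> S" "(u, u) \<notin> parcs G" "(w, u) \<in> parcs G"
      using ipath_ends[OF step.hyps(1)] no_loops' arc_sym[OF step.hyps(2)] by blast+
    then show "e \<in> {e \<in> parcs G. fst e \<in> insert u S \<and> snd e \<in> insert u S} \<longleftrightarrow>
        e \<in> {(u, w), (w, u)} \<union> {e \<in> parcs G. fst e \<in> S \<and> snd e \<in> S}"
      using step.hyps(2,3) step.hyps(4)[of a] step.hyps(4)[of b] arc_sym[of a b] e by auto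
  qed
  ultimately have "induced_path G u (u # p) v"
    using p ne step.hyps(2,3) in_arcsD1[OF step.hyps(2)]
    by (auto simp: induced_path_def vpath_def vwalk_def induce_subgraph_def)
  then show ?case using p(2) by (intro exI[of _ "u # p"]) simp
qed

lemma mono_interval_eq: "mono_interval G u v = {u, v} \<union> \<Union> {S. ipath G u S v}"
proof -
  have "(\<exists>p. induced_path G u p v \<and> w \<in> set p) \<longleftrightarrow> (\<exists>S. ipath G u S v \<and> w \<in> S)" for w
    using ipath_if_induced_path induced_path_if_ipath by metis
  then show ?thesis unfolding mono_interval_def by blast
qed

text \<open>Of the four choices of ends in \<open>{u, v}\<close>, equal ends contribute only
  themselves, and a path from \<open>v\<close> to \<open>u\<close> can be reversed.\<close>

lemma monophonic_pairD:
  assumes "monophonic_set G {u, v}" "w \<in> pverts G" "w \<noteq> u" "w \<noteq> v"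
  shows "\<exists>S. ipath G u S v \<and> w \<in> S"
proof -
  obtain x y where "x \<in> {u, v}" "y \<in> {u, v}" "w \<in> mono_interval G x y"
    using assms unfolding monophonic_set_def by blast
  then show ?thesis using assms(3,4)
    by (auto simp: mono_interval_eq dest: ipath_rev ipath_to_self)
qed

lemma monophonic_pairI:
  assumes "u \<in> pverts G" "v \<in> pverts G" "\<And>w. w \<in> pverts G \<Longrightarrow> \<exists>S. ipath G u S v \<and> w \<in> S"
  shows "monophonic_set G {u, v}"
  unfolding monophonic_set_def
proof (intro conjI ballI)
  fix w assume "w \<in> pverts G"
  then have "w \<in> mono_interval G u v" using assms(3) unfolding mono_interval_eq by blast
  then show "\<exists>x\<in>{u, v}. \<exists>y\<in>{u, v}. w \<in> mono_interval G x y" by blast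
qed (use assms(1,2) in simp)

text \<open>The set of all vertices is monophonic, so a minimum of 2 forces two vertices, and an
  induced path between them starts with an edge.\<close>

lemma two_monophonic_imp_arc:
  assumes "Digraph_Component.connected (with_proj G)" "two_monophonic G"
  shows "\<exists>u v. (u, v) \<in> parcs G"
proof -
  have "monophonic_set G (pverts G)"
    by (auto simp: monophonic_set_def mono_interval_def)
  then have "monophonic_number G \<le> card (pverts G)"
    unfolding monophonic_number_def by (intro Least_le) blast
  then have "card (pverts G) \<ge> 2"
    using assms by (simp add: two_monophonic_def)
  then have "\<not> card (pverts G) \<le> Suc 0" by simp
  then obtain u v where "u \<in> pverts G" "v \<in> pverts G" "u \<noteq> v"
    using card_le_Suc0_iff_eq[OF pair_finite_verts] by fastforce
  moreover from this obtain S where "ipath G u S v"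
    using ipath_if_connected assms by metis
  ultimately show ?thesis by (blast elim: ipath.cases)
qed

text \<open>A set with at most one element covers at most one vertex, because
  \<open>mono_interval G s s\<close> is \<open>{s}\<close>; this gives the lower bound.\<close>

lemma two_monophonicI:
  assumes "u \<noteq> v" "monophonic_set G {u, v}"
  shows "two_monophonic G"
  unfolding two_monophonic_def monophonic_number_def
proof (rule Least_equality)
  show "\<exists>S. monophonic_set G S \<and> card S = 2" using assms by (intro exI[of _ "{u, v}"]) auto
  fix k assume "\<exists>S. monophonic_set G S \<and> card S = k"
  then obtain S where S: "monophonic_set G S" "card S = k" by blast
  have "finite S" using S pair_finite_verts by (auto simp: monophonic_set_def intro: finite_subset)
  have uv: "u \<in> pverts G" "v \<in> pverts G" using assms by (auto simp: monophonic_set_def)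
  show "2 \<le> k"
  proof (rule ccontr)
    assume "\<not> 2 \<le> k"
    then have "S = {} \<or> (\<exists>s. S = {s})"
      using S(2) \<open>finite S\<close> card_1_singletonE[of S] by (cases "k = 0") auto
    then have "w = w'" if "w \<in> pverts G" "w' \<in> pverts G" for w w'
      using that S(1) by (fastforce simp: monophonic_set_def mono_interval_refl)
    then show False using uv assms(1) by blast
  qed
qed

section \<open>Absence of cut vertices\<close>

text \<open>On an induced path the end \<open>x\<close> is adjacent only to its successor, so
  \<open>g\<close> comes second; then \<open>y\<close>, a neighbour of \<open>g\<close>, comes third
  and ends the path.\<close>

lemma ipath_through_common_neighbour:
  assumes "ipath G x S y" "g \<in> S" "(x, g) \<in> parcs G" "(g, y) \<in> parcs G"
  shows "S = {x, g, y}"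
  using assms(1)
proof cases
  case single
  then show ?thesis using assms by (auto dest: no_loops')
next
  case (step w T)
  have "g \<in> T" using step assms by (auto dest: no_loops')
  then have [simp]: "w = g" using step assms by auto
  from step(2) show ?thesis
  proof cases
    case single
    then show ?thesis using assms by (auto dest: no_loops')
  next
    case step': (step w' T')
    have "y \<in> T'" using ipath_ends[OF step'(2)] by simp
    then have "w' = y" using step' assms by auto
    then have "T' = {y}" using ipath_to_self[OF step'(2)] by simp
    then show ?thesis using step step' by auto
  qed
qed

text \<open>Used by contraposition, to supply a fourth vertex when \<open>x\<close> and
  \<open>y\<close> are nonadjacent neighbours of \<open>g\<close>.\<close>

lemma P3_iso:
  assumes V: "pverts G = {x, g, y}" and arcs: "(x, g) \<in> parcs G" "(g, y) \<in> parcs G"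
    and xy: "x \<noteq> y" "(x, y) \<notin> parcs G"
  shows "digraph_iso (with_proj G) (with_proj (path_graph 3))"
proof -
  define f where "f = (\<lambda>a. if a = x then 0 else if a = g then 1 else 2 :: nat)"
  define hom where "hom = \<lparr>iso_verts = f, iso_arcs = map_prod f f, iso_head = snd, iso_tail = fst\<rparr>"
  have ne: "x \<noteq> g" "g \<noteq> y" using arcs by (auto dest: no_loops')
  have "inj_on f (pverts G)" using ne xy unfolding V by (auto simp: inj_on_def f_def)
  have A: "parcs G = {(x, g), (g, x), (g, y), (y, g)}"
  proof (rule set_eqI)
    fix e
    obtain a b :: 'a where e: "e = (a, b)" by fastforce
    have loop: "(a, a) \<notin> parcs G" using no_loops' by blast
    show "e \<in> parcs G \<longleftrightarrow> e \<in> {(x, g), (g, x), (g, y), (y, g)}"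
    proof
      assume "e \<in> parcs G"
      then have "a \<in> {x, g, y}" "b \<in> {x, g, y}" "a \<noteq> b" "(b, a) \<in> parcs G" "(a, b) \<in> parcs G"
        using e loop in_arcsD1[of a b] in_arcsD2[of a b] arc_sym[of a b] unfolding V by blast+
      then show "e \<in> {(x, g), (g, x), (g, y), (y, g)}" using e xy(2) by auto
    qed (use arcs arc_sym[OF arcs(1)] arc_sym[OF arcs(2)] in auto)
  qed
  have "inj_on (map_prod f f) (parcs G)"
    using ne xy unfolding A by (auto simp: inj_on_def f_def)
  moreover have "wf_digraph (with_proj G)" by unfold_locales
  ultimately have "pre_digraph.digraph_isomorphism (with_proj G) hom"
    using \<open>inj_on f (pverts G)\<close> by (auto simp: pre_digraph.digraph_isomorphism_def hom_def)
  moreover have "f ` pverts G = {..<3}" using ne xy unfolding V by (auto simp: f_def)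
  moreover have "map_prod f f ` parcs G = {(i, j). i < 3 \<and> j < 3 \<and> (j = Suc i \<or> i = Suc j)}"
    using ne xy unfolding A by (auto simp: f_def)
  ultimately show ?thesis
    unfolding digraph_iso_def app_iso_def with_proj_def path_graph_def
    by (intro exI[of _ hom]) (simp add: hom_def)
qed

lemma ipath_avoiding:
  assumes "strongly_two_monophonic G" "\<not> digraph_iso (with_proj G) (with_proj (path_graph 3))"
    and g: "(x, g) \<in> parcs G" "(g, y) \<in> parcs G"
  obtains S where "ipath G x S y" "g \<notin> S"
proof -
  have V: "x \<in> pverts G" "g \<in> pverts G" "y \<in> pverts G" "g \<noteq> x" "g \<noteq> y"
    using g by (auto dest: in_arcsD1 in_arcsD2 no_loops')
  consider "x = y" | "(x, y) \<in> parcs G" | "x \<noteq> y" "(x, y) \<notin> parcs G" by blast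
  then show ?thesis
  proof cases
    case 1
    then show ?thesis using that[of "{x}"] V ipath.single by fast
  next
    case 2
    then show ?thesis using that[OF ipath_edge] V by blast
  next
    case 3
    then have "pverts G \<noteq> {x, g, y}" using P3_iso g assms(2) by blast
    then obtain w where w: "w \<in> pverts G" "w \<notin> {x, g, y}" using V by blast
    have "monophonic_set G {x, y}"
      using assms(1) V 3 by (auto simp: strongly_two_monophonic_def)
    then obtain S where "ipath G x S y" "w \<in> S" using w monophonic_pairD by blast
    moreover from this have "g \<notin> S"
      using ipath_through_common_neighbour g w by blast
    ultimately show ?thesis using that by blast
  qed
qed

section \<open>Pairs of paths meeting in a single vertex\<close>

text \<open>Edges between \<open>R\<close> and \<open>S\<close> are allowed: in the product the two
  paths lie in different layers, where such edges disappear.\<close>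

definition fan :: "'a \<Rightarrow> 'a \<Rightarrow> 'a \<Rightarrow> bool" where
  "fan u x v \<longleftrightarrow> (\<exists>R S. ipath G u R x \<and> ipath G x S v \<and> R \<inter> S = {x})"

lemma fan_sym:
  assumes "fan u x v"
  shows "fan v x u"
proof -
  obtain R S where "ipath G u R x" "ipath G x S v" "R \<inter> S = {x}"
    using assms unfolding fan_def by (elim exE conjE)
  then have "ipath G v S x \<and> ipath G x R u \<and> S \<inter> R = {x}"
    by (simp add: ipath_rev Int_commute)
  then show ?thesis unfolding fan_def by (intro exI)
qed

text \<open>One new path follows \<open>R\<close> from \<open>u\<close> to \<open>z\<close> and then
  \<open>P\<close> backwards to \<open>x'\<close>; the other goes from \<open>x'\<close> to
  \<open>x\<close> and along \<open>S\<close>, both up to shortcuts. The first avoids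
  \<open>S\<close> altogether, because \<open>R\<close> meets \<open>S\<close> only in
  \<open>x\<close> and \<open>P\<close> meets \<open>R \<union> S\<close> only in
  \<open>z\<close>.\<close>

lemma fan_step:
  assumes R: "ipath G u R x" "ipath G x S v" "R \<inter> S = {x}"
    and x': "(x, x') \<in> parcs G" and P: "ipath G x' P z" "x \<notin> P" "P \<inter> (R \<union> S) = {z}" "z \<in> R"
  shows "fan u x' v"
proof -
  obtain A B where A: "ipath G u A z" "ipath G z B x" "A \<inter> B = {z}" "A \<union> B = R"
    using ipath_split R(1) P(4) by blast
  have "z \<noteq> x" using P by blast
  then have "x \<notin> A" using ipath_ends[OF A(2)] A(3) by auto
  obtain T1 where T1: "T1 \<subseteq> A \<union> P" "ipath G u T1 x'"
    using ipath_concat[OF A(1) ipath_rev[OF P(1)]] by blast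
  obtain T2 where T2: "T2 \<subseteq> insert x' S" "ipath G x' T2 v"
    using ipath_extend[OF R(2), of x'] arc_sym[OF x'] R(2) by (blast dest: ipath_ends)
  have "T1 \<inter> T2 = {x'}"
  proof -
    have RS: "a = x" if "a \<in> R" "a \<in> S" for a using R(3) that by blast
    have PR: "a = z" if "a \<in> P" "a \<in> S" for a using P(3) that by blast
    have "a = x'" if "a \<in> T1" "a \<in> T2" for a
      using that T1(1) T2(1) RS PR \<open>x \<notin> A\<close> A(4) P(4) \<open>z \<noteq> x\<close> by (metis UnCI UnE insertE subsetD)
    then show ?thesis using ipath_ends[OF T1(2)] ipath_ends[OF T2(2)] by auto
  qed
  then show ?thesis using T1(2) T2(2) unfolding fan_def by (intro exI conjI)
qed

text \<open>
  Induction along a path from \<open>u\<close> to \<open>x\<close>: the fan of the predecessor of \<open>x\<close> is rerouted along a path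
  from \<open>x\<close> that avoids this predecessor.
\<close>

lemma fan_exists:
  assumes G: "strongly_two_monophonic G" "\<not> digraph_iso (with_proj G) (with_proj (path_graph 3))"
    and uv: "(u, v) \<in> parcs G"
  shows "ipath G x T w \<Longrightarrow> w = u \<Longrightarrow> fan u x v"
proof (induction rule: ipath.induct)
  case (single w)
  then show ?case unfolding fan_def using ipath_edge[OF uv]
    by (intro exI[of _ "{u}"] exI[of _ "{u, v}"]) (auto intro: ipath.single)
next
  case (step x T w x')
  then obtain R S where R: "ipath G u R x" "ipath G x S v" "R \<inter> S = {x}"
    unfolding fan_def by blast
  have "u \<noteq> v" using uv by (auto dest: no_loops')
  \<comment> \<open>Such a \<open>y\<close> is the neighbour of \<open>x\<close> along one of the
    two paths; for \<open>x = v\<close> the path \<open>S\<close> is trivial and \<open>R\<close>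
    supplies it.\<close>
  have "\<exists>y \<in> R \<union> S. (x, y) \<in> parcs G"
  proof (cases "x = v")
    case True
    then have "ipath G x R u" "x \<noteq> u" using R \<open>u \<noteq> v\<close> ipath_rev by auto
    then show ?thesis by cases (auto dest: ipath_ends)
  next
    case False
    with R(2) show ?thesis by cases (auto dest: ipath_ends)
  qed
  then obtain y where y: "y \<in> R \<union> S" "(x, y) \<in> parcs G" by blast
  \<comment> \<open>The vertex \<open>x\<close> is a common neighbour of \<open>x'\<close> and
    \<open>y\<close>, so there is a detour around it.\<close>
  obtain P where "ipath G x' P y" "x \<notin> P"
    using ipath_avoiding[OF G step.hyps(2) y(2)] by blast
  then obtain Q z where Q: "ipath G x' Q z" "x \<notin> Q" "Q \<inter> (R \<union> S) = {z}"
    using ipath_first_hit[OF _ y(1)] by (metis subsetD)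
  then consider "z \<in> R" | "z \<in> S" by blast
  then show ?case
  proof cases
    case 1
    then show ?thesis using fan_step[OF R arc_sym[OF step.hyps(2)] Q] by blast
  next
    case 2
    \<comment> \<open>If the detour hits \<open>S\<close>, the roles of \<open>u\<close> and
      \<open>v\<close> are exchanged.\<close>
    have "fan v x' u"
      using fan_step[OF ipath_rev[OF R(2)] ipath_rev[OF R(1)] _ arc_sym[OF step.hyps(2)] Q(1,2) _ 2]
        R(3) Q(3) by (simp add: Un_commute Int_commute)
    then show ?thesis by (rule fan_sym)
  qed
qed

end

section \<open>Induced paths in the product\<close>

lemma verts_cart_prod [simp]: "pverts (G \<box> H) = pverts G \<times> pverts H"
  by (simp add: cart_prod_def)

lemma arcs_cart_prod [simp]:
  assumes "pair_graph G" "pair_graph H"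
  shows "((g, h), (g', h')) \<in> parcs (G \<box> H) \<longleftrightarrow>
    g = g' \<and> g \<in> pverts G \<and> (h, h') \<in> parcs H \<or> h = h' \<and> h \<in> pverts H \<and> (g, g') \<in> parcs G"
proof -
  interpret G: pair_graph G by fact
  interpret H: pair_graph H by fact
  show ?thesis by (auto simp: cart_prod_def dest: G.wellformed' H.wellformed')
qed

lemma ipath_swap:
  assumes "pair_graph G" "pair_graph H"
  shows "ipath (G \<box> H) u S v \<Longrightarrow> ipath (H \<box> G) (prod.swap u) (prod.swap ` S) (prod.swap v)"
proof (induction rule: ipath.induct)
  case (single v)
  then show ?case by (cases v) (auto intro!: ipath.single)
next
  case (step w S v u)
  have arc: "(prod.swap a, prod.swap b) \<in> parcs (H \<box> G) \<longleftrightarrow> (a, b) \<in> parcs (G \<box> H)" for a b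
    using assms by (cases a; cases b) auto
  show ?case unfolding image_insert
  proof (rule ipath.step[OF step.IH])
    show "(prod.swap u, prod.swap w) \<in> parcs (H \<box> G)" using step.hyps(2) by (simp only: arc)
    show "prod.swap u \<notin> prod.swap ` S"
      using step.hyps(3) by (simp add: inj_image_mem_iff)
    show "s = prod.swap w" if "s \<in> prod.swap ` S" "(prod.swap u, s) \<in> parcs (H \<box> G)" for s
      using that step.hyps(4) by (auto simp only: arc image_iff)
  qed
qed

lemma ipath_cart_prod_left:
  assumes "pair_graph G" "pair_graph H" "h \<in> pverts H"
  shows "ipath G u S v \<Longrightarrow> ipath (G \<box> H) (u, h) (S \<times> {h}) (v, h)"
proof (induction rule: ipath.induct)
  case (single v)
  then show ?case using assms(3) ipath.single[of "(v, h)" "G \<box> H"] by simp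
next
  case (step w S v u)
  interpret H: pair_graph H by fact
  have "ipath (G \<box> H) (u, h) (insert (u, h) (S \<times> {h})) (v, h)"
    using step.hyps assms by (intro ipath.step[OF step.IH]) (auto dest: H.no_loops')
  moreover have "insert (u, h) (S \<times> {h}) = insert u S \<times> {h}" by auto
  ultimately show ?case by (simp only:)
qed

lemma ipath_cart_prod_right:
  assumes "pair_graph G" "pair_graph H" "g \<in> pverts G" "ipath H u S v"
  shows "ipath (G \<box> H) (g, u) ({g} \<times> S) (g, v)"
proof -
  have "ipath (H \<box> G) (u, g) (S \<times> {g}) (v, g)"
    using ipath_cart_prod_left[OF assms(2,1,3,4)] .
  from ipath_swap[OF assms(2,1) this] show ?thesis by (simp only: product_swap swap_simp)
qed

text \<open>The heights \<open>h\<close> and \<open>h'\<close> are neither equal nor adjacent, so no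
  edge joins the two layers and \<open>R1\<close>, \<open>R2\<close> may overlap freely.\<close>

lemma ipath_cart_prod_nonadjacent:
  assumes G: "pair_graph G" and H: "pair_graph H"
    and R: "ipath G g R1 x" "ipath G x R2 g'" and Q: "ipath H h Q h'"
    and h: "h \<noteq> h'" "(h, h') \<notin> parcs H"
  shows "ipath (G \<box> H) (g, h) (R1 \<times> {h} \<union> {x} \<times> Q \<union> R2 \<times> {h'}) (g', h')"
proof -
  interpret G: pair_graph G by fact
  interpret H: pair_graph H by fact
  have x: "x \<in> R1" "x \<in> R2" "h \<in> Q" "h' \<in> Q" using R Q by (simp_all add: ipath_ends)
  then have V: "x \<in> pverts G" "h \<in> pverts H" "h' \<in> pverts H"
    using R Q G.ipath_vertices H.ipath_vertices by blast+
  note left = ipath_cart_prod_left[OF G H] and right = ipath_cart_prod_right[OF G H]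
  have "ipath (G \<box> H) (g, h) (R1 \<times> {h} \<union> {x} \<times> Q) (x, h')"
    by (rule ipath_append[OF left[OF V(2) R(1)] right[OF V(1) Q]]) (use x G H in auto)
  then show ?thesis
    by (rule ipath_append[OF _ left[OF V(3) R(2)]]) (use x h G H in auto)
qed

text \<open>An edge between the layers at \<open>h\<close> and \<open>y\<close> stands over a common
  vertex of \<open>R1\<close> and \<open>R2\<close>, hence over \<open>x\<close>; likewise an edge
  between the columns at \<open>x\<close> and \<open>g'\<close> has height \<open>y\<close>. So the
  corners are the only contacts. The conditions \<open>ne\<close> keep the two layers and the two
  columns distinct.\<close>

lemma ipath_cart_prod_fans:
  assumes G: "pair_graph G" and H: "pair_graph H"
    and R: "ipath G g R1 x" "ipath G x R2 g'" "R1 \<inter> R2 = {x}"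
    and S: "ipath H h S1 y" "ipath H y S2 h'" "S1 \<inter> S2 = {y}"
    and ne: "x \<noteq> g'" "y \<noteq> h"
  shows "ipath (G \<box> H) (g, h) (R1 \<times> {h} \<union> {x} \<times> S1 \<union> R2 \<times> {y} \<union> {g'} \<times> S2) (g', h')"
proof -
  interpret G: pair_graph G by fact
  interpret H: pair_graph H by fact
  have x: "x \<in> R1" "x \<in> R2" "g' \<in> R2" "h \<in> S1" "y \<in> S1" "y \<in> S2" using R S by (simp_all add: ipath_ends)
  then have V: "x \<in> pverts G" "g' \<in> pverts G" "h \<in> pverts H" "y \<in> pverts H"
    using R S G.ipath_vertices H.ipath_vertices by blast+
  have R_only: "r = x" if "r \<in> R1" "r \<in> R2" for r using that R(3) by blast
  have S_only: "s = y" if "s \<in> S1" "s \<in> S2" for s using that S(3) by blast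
  \<comment> \<open>This rules out contact between the first layer and the last column.\<close>
  have "g' \<notin> R1" "h \<notin> S2" using R_only S_only x ne by blast+
  note left = ipath_cart_prod_left[OF G H] and right = ipath_cart_prod_right[OF G H]
  have "ipath (G \<box> H) (g, h) (R1 \<times> {h} \<union> {x} \<times> S1) (x, y)"
    by (rule ipath_append[OF left[OF V(3) R(1)] right[OF V(1) S(1)]]) (use x G H in auto)
  then have "ipath (G \<box> H) (g, h) (R1 \<times> {h} \<union> {x} \<times> S1 \<union> R2 \<times> {y}) (g', y)"
  proof (rule ipath_append[OF _ left[OF V(4) R(2)]])
    show "(R1 \<times> {h} \<union> {x} \<times> S1) \<inter> (R2 \<times> {y}) = {(x, y)}"
      using x ne by auto
    show "(s, t) \<notin> parcs (G \<box> H)"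
      if "s \<in> R1 \<times> {h} \<union> {x} \<times> S1 - {(x, y)}" "t \<in> R2 \<times> {y} - {(x, y)}" for s t
      using that R_only ne G H by auto
  qed
  then show ?thesis
  proof (rule ipath_append[OF _ right[OF V(2) S(2)]])
    show "(R1 \<times> {h} \<union> {x} \<times> S1 \<union> R2 \<times> {y}) \<inter> ({g'} \<times> S2) = {(g', y)}"
      using x ne \<open>g' \<notin> R1\<close> by auto
    show "(s, t) \<notin> parcs (G \<box> H)"
      if "s \<in> R1 \<times> {h} \<union> {x} \<times> S1 \<union> R2 \<times> {y} - {(g', y)}" "t \<in> {g'} \<times> S2 - {(g', y)}" for s t
      using that S_only ne \<open>g' \<notin> R1\<close> \<open>h \<notin> S2\<close> G H by auto
  qed
qed

section \<open>Reaching every vertex of the product\<close>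

lemma ipath_through_nonadjacent:
  assumes G: "pair_graph G" "Digraph_Component.connected (with_proj G)"
    and H: "pair_graph H" "strongly_two_monophonic H" "Digraph_Component.connected (with_proj H)"
    and V: "g \<in> pverts G" "g' \<in> pverts G" "h \<in> pverts H" "h' \<in> pverts H"
    and h: "h \<noteq> h'" "(h, h') \<notin> parcs H"
    and w: "x \<in> pverts G" "y \<in> pverts H"
  shows "\<exists>S. ipath (G \<box> H) (g, h) S (g', h') \<and> (x, y) \<in> S"
proof -
  interpret G: pair_graph G by fact
  interpret H: pair_graph H by fact
  obtain R1 R2 where R: "ipath G g R1 x" "ipath G x R2 g'"
    using G.ipath_if_connected[OF G(2) V(1) w(1)] G.ipath_if_connected[OF G(2) w(1) V(2)] by blast
  have "monophonic_set H {h, h'}"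
    using H(2) V h by (auto simp: strongly_two_monophonic_def)
  obtain Q where "ipath H h Q h'" "y \<in> Q"
  \<comment> \<open>An endpoint lies in the interval by convention, which yields no path;
    connectivity provides one.\<close>
  proof (cases "y = h \<or> y = h'")
    case True
    from H.ipath_if_connected[OF H(3) V(3,4)] obtain Q where "ipath H h Q h'" ..
    with True show ?thesis using that ipath_ends by metis
  next
    case False
    then show ?thesis using H.monophonic_pairD[OF \<open>monophonic_set H {h, h'}\<close> w(2)] that by blast
  qed
  with ipath_cart_prod_nonadjacent[OF G(1) H(1) R _ h] show ?thesis by blast
qed

lemma ipath_through_adjacent:
  assumes G: "pair_graph G" and H: "pair_graph H"
    and g: "(g, g') \<in> parcs G" "pair_graph.fan G g x g'"
    and h: "(h, h') \<in> parcs H" "pair_graph.fan H h y h'"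
  shows "\<exists>S. ipath (G \<box> H) (g, h) S (g', h') \<and> (x, y) \<in> S"
proof -
  interpret G: pair_graph G by fact
  interpret H: pair_graph H by fact
  obtain R1 R2 where R: "ipath G g R1 x" "ipath G x R2 g'" "R1 \<inter> R2 = {x}"
    using g(2)[unfolded G.fan_def] by (elim exE conjE)
  obtain S1 S2 where S: "ipath H h S1 y" "ipath H y S2 h'" "S1 \<inter> S2 = {y}"
    using h(2)[unfolded H.fan_def] by (elim exE conjE)
  have in_R: "x \<in> R1" and in_S: "y \<in> S1" using R S by (simp_all add: ipath_ends)
  have ne: "g \<noteq> g'" "h \<noteq> h'" using g h by (auto dest: G.no_loops' H.no_loops')
  have V: "g \<in> pverts G" "g' \<in> pverts G" "h \<in> pverts H" "h' \<in> pverts H"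
    using g(1) h(1) by (auto dest: G.wellformed' H.wellformed')
  \<comment> \<open>Both staircases fail only if \<open>(x, y)\<close> is an endpoint of the desired
    path; then any path will do, and this one turns at \<open>(g', h)\<close>.\<close>
  have corner: "ipath (G \<box> H) (g, h) ({g, g'} \<times> {h} \<union> {g'} \<times> {h, h'}) (g', h')"
    by (rule ipath_append[OF ipath_cart_prod_left[OF G H V(3) G.ipath_edge[OF g(1)]]
          ipath_cart_prod_right[OF G H V(2) H.ipath_edge[OF h(1)]]])
      (use ne G H in auto)
  consider "x \<noteq> g'" "y \<noteq> h" | "x \<noteq> g" "y \<noteq> h'" | "x = g" "y = h" | "x = g'" "y = h'"
    using ne by blast
  then show ?thesis
  proof cases
    case 1
    then show ?thesis using ipath_cart_prod_fans[OF G H R S] in_R in_S by blast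
  next
    case 2
    \<comment> \<open>The second staircase is the first one with the factors exchanged.\<close>
    have "ipath (H \<box> G) (h, g) (S1 \<times> {g} \<union> {y} \<times> R1 \<union> S2 \<times> {x} \<union> {h'} \<times> R2) (h', g')"
      using ipath_cart_prod_fans[OF H G S R] 2 by blast
    from ipath_swap[OF H G this] show ?thesis
      using in_R by (intro exI conjI) auto
  next
    case 3
    then show ?thesis using corner by (blast dest: ipath_ends)
  next
    case 4
    then show ?thesis using corner by (blast dest: ipath_ends)
  qed
qed

theorem theorem3p10:
  fixes G :: "'a pair_pre_digraph" and H :: "'b pair_pre_digraph"
  assumes "pair_graph G" and "pair_graph H"
    and "Digraph_Component.connected (with_proj G)" and "Digraph_Component.connected (with_proj H)"
    and "strongly_two_monophonic G" and "strongly_two_monophonic H"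
    and "\<not> digraph_iso (with_proj G) (with_proj (path_graph 3))"
    and "\<not> digraph_iso (with_proj H) (with_proj (path_graph 3))"
  shows "strongly_two_monophonic (G \<box> H)"
proof -
  interpret G: pair_graph G by fact
  interpret H: pair_graph H by fact
  have GH: "pair_graph (G \<box> H)" using assms(1,2) by (rule pair_graph_cart_prod)
  have through: "\<exists>S. ipath (G \<box> H) (g, h) S (g', h') \<and> (x, y) \<in> S"
    if V: "g \<in> pverts G" "h \<in> pverts H" "g' \<in> pverts G" "h' \<in> pverts H"
      and ne: "(g, h) \<noteq> (g', h')" "((g, h), (g', h')) \<notin> parcs (G \<box> H)"
      and w: "x \<in> pverts G" "y \<in> pverts H" for g h g' h' x y
  proof -
    \<comment> \<open>If neither coordinate gives a distinct nonadjacent pair, each is an equality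
      or an edge, and an equality in either would make the two vertices equal or adjacent.\<close>
    consider "h \<noteq> h'" "(h, h') \<notin> parcs H" | "g \<noteq> g'" "(g, g') \<notin> parcs G"
      | "(g, g') \<in> parcs G" "(h, h') \<in> parcs H"
      using V ne assms(1,2) by auto
    then show ?thesis
    proof cases
      case 1
      show ?thesis
        using ipath_through_nonadjacent[OF assms(1,3,2,6,4) V(1,3,2,4) 1 w] .
    next
      case 2
      from ipath_through_nonadjacent[OF assms(2,4,1,5,3) V(2,4,1,3) 2 w(2,1)]
      obtain S where S: "ipath (H \<box> G) (h, g) S (h', g')" "(y, x) \<in> S" by (elim exE conjE)
      have "(x, y) \<in> prod.swap ` S" using imageI[OF S(2), of prod.swap] by (simp only: swap_simp)
      with ipath_swap[OF assms(2,1) S(1)] show ?thesis by (intro exI conjI) (simp_all only: swap_simp)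
    next
      case 3
      have "G.fan g x g'"
        using G.ipath_if_connected[OF assms(3) w(1) V(1)] G.fan_exists[OF assms(5,7) 3(1) _ refl]
        by (elim exE)
      moreover have "H.fan h y h'"
        using H.ipath_if_connected[OF assms(4) w(2) V(2)] H.fan_exists[OF assms(6,8) 3(2) _ refl]
        by (elim exE)
      ultimately show ?thesis
        using ipath_through_adjacent[OF assms(1,2)] 3 by simp
    qed
  qed
  have mono: "monophonic_set (G \<box> H) {u, v}"
    if "u \<in> pverts (G \<box> H)" "v \<in> pverts (G \<box> H)" "u \<noteq> v" "(u, v) \<notin> parcs (G \<box> H)" for u v
  proof (rule pair_graph.monophonic_pairI[OF GH])
    fix w assume "w \<in> pverts (G \<box> H)"
    then show "\<exists>S. ipath (G \<box> H) u S v \<and> w \<in> S"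
      using through[of "fst u" "snd u" "fst v" "snd v" "fst w" "snd w"] that
      by (cases u; cases v; cases w) simp
  qed fact+
  \<comment> \<open>Opposite corners of a product of two edges are nonadjacent, so they form a
    monophonic pair that attains the minimum 2.\<close>
  obtain g g' where g: "(g, g') \<in> parcs G"
    using G.two_monophonic_imp_arc[OF assms(3)] assms(5) unfolding strongly_two_monophonic_def by blast
  obtain h h' where h: "(h, h') \<in> parcs H"
    using H.two_monophonic_imp_arc[OF assms(4)] assms(6) unfolding strongly_two_monophonic_def by blast
  have ne: "g \<noteq> g'" "h \<noteq> h'" using g h by (auto dest: G.no_loops' H.no_loops')
  have "two_monophonic (G \<box> H)"
  proof (rule pair_graph.two_monophonicI[OF GH])
    show "monophonic_set (G \<box> H) {(g, h), (g', h')}"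
      using g h ne assms(1,2) by (intro mono) (auto dest: G.wellformed' H.wellformed')
  qed (use ne in simp)
  with mono show ?thesis by (auto simp: strongly_two_monophonic_def)
qed

end
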